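(* Let $K$ be a field and $R=L_K(\mathcal{T})$. The left $R$-module $Y$ is the injective envelope of the simple left $R$-module $Rw$.
   Context: $R=L_K(\mathcal{T})$ is the Leavitt path algebra over the field $K$ of the graph $\mathcal{T}$ with two vertices $v,w$, a loop $c$ at $v$, and one edge $d$ from $v$ to $w$. That is, $R$ is the unital associative $K$-algebra generated by $v,w,c,d,c^*,d^*$ with relations $v^2=v$, $w^2=w$, $vw=wv=0$, $v+w=1_R$, $c=vc=cv$, $c^*=vc^*=c^*v$, $d=vd=dw$, $d^*=wd^*=d^*v$, $c^*c=v$, $d^*d=w$, $c^*d=d^*c=0$, $cc^*+dd^*=v$. "Module" means left module. $Y$ is the $K$-space of all formal series $y=k_{-1}w+k_0d+k_1cd+\cdots+k_ic^id+\cdots$ with $k_i\in K$ (no finiteness condition), made into a left $R$-module by $c\cdot y=k_0cd+k_1c^2d+\cdots+k_ic^{i+1}d+\cdots$; $c^*\cdot y=k_1d+k_2cd+\cdots+k_ic^{i-1}d+\cdots$; $d\cdot y=k_{-1}d$; $d^*\cdot y=k_0w$; $v\cdot y=k_0d+k_1cd+\cdots+k_ic^id+\cdots$; $w\cdot y=k_{-1}w$. The left ideal $Rw$ has $K$-basis $\{w,d,cd,c^2d,\dots\}$, and is regarded as the $R$-submodule of $Y$ consisting of the series with only finitely many nonzero coefficients. *)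

theory Defs
  imports "HOL-Algebra.Algebraic_Closure_Type" "HOL-Algebra.QuotRing" "HOL-Algebra.Module"
    "HOL-Library.Poly_Mapping"
begin

section \<open>Left modules over a ring that need not be commutative\<close>

text \<open>
  The locale \<^locale>\<open>module\<close> requires a commutative ring of scalars. The following is the same list of
  axioms over an arbitrary ring with unit. As in the library, the fields \<^const>\<open>monoid.mult\<close> and \<^const>\<open>one\<close> of
  a module record carry no meaning. The locale \<^locale>\<open>submodule\<close> makes no assumption on the scalars and
  is used as it is.
\<close>

locale left_module = R?: ring R + M?: abelian_group M
  for R :: "('r, 's) ring_scheme" (structure) and M :: "('r, 'm, 't) module_scheme" (structure) +
  assumes smult_closed:
      "\<lbrakk>a \<in> carrier R; x \<in> carrier M\<rbrakk> \<Longrightarrow> a \<odot>\<^bsub>M\<^esub> x \<in> carrier M"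
    and smult_l_distr:
      "\<lbrakk>a \<in> carrier R; b \<in> carrier R; x \<in> carrier M\<rbrakk> \<Longrightarrow>
        (a \<oplus>\<^bsub>R\<^esub> b) \<odot>\<^bsub>M\<^esub> x = a \<odot>\<^bsub>M\<^esub> x \<oplus>\<^bsub>M\<^esub> b \<odot>\<^bsub>M\<^esub> x"
    and smult_r_distr:
      "\<lbrakk>a \<in> carrier R; x \<in> carrier M; y \<in> carrier M\<rbrakk> \<Longrightarrow>
        a \<odot>\<^bsub>M\<^esub> (x \<oplus>\<^bsub>M\<^esub> y) = a \<odot>\<^bsub>M\<^esub> x \<oplus>\<^bsub>M\<^esub> a \<odot>\<^bsub>M\<^esub> y"
    and smult_assoc1:
      "\<lbrakk>a \<in> carrier R; b \<in> carrier R; x \<in> carrier M\<rbrakk> \<Longrightarrow>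
        (a \<otimes>\<^bsub>R\<^esub> b) \<odot>\<^bsub>M\<^esub> x = a \<odot>\<^bsub>M\<^esub> (b \<odot>\<^bsub>M\<^esub> x)"
    and smult_one:
      "x \<in> carrier M \<Longrightarrow> \<one>\<^bsub>R\<^esub> \<odot>\<^bsub>M\<^esub> x = x"

definition module_homs ::
    "('r, 's) ring_scheme \<Rightarrow> ('r, 'm) module \<Rightarrow> ('r, 'n) module \<Rightarrow> ('m \<Rightarrow> 'n) set" where
  "module_homs R M N =
    {f \<in> hom (add_monoid M) (add_monoid N).
      \<forall>r\<in>carrier R. \<forall>x\<in>carrier M. f (r \<odot>\<^bsub>M\<^esub> x) = r \<odot>\<^bsub>N\<^esub> f x}"

definition simple_module :: "('r, 's) ring_scheme \<Rightarrow> ('r, 'm) module \<Rightarrow> bool" where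
  "simple_module R M \<longleftrightarrow>
    left_module R M \<and> carrier M \<noteq> {\<zero>\<^bsub>M\<^esub>} \<and>
    (\<forall>N. submodule N R M \<longrightarrow> N = {\<zero>\<^bsub>M\<^esub>} \<or> N = carrier M)"

text \<open>
  A definition cannot quantify over types. The two type arguments name the types in which the carriers
  of the test modules \<open>A\<close> and \<open>B\<close> live; a statement in which they are type variables covers all modules.
\<close>

definition injective_module ::
    "'a itself \<Rightarrow> 'b itself \<Rightarrow> ('r, 's) ring_scheme \<Rightarrow> ('r, 'e) module \<Rightarrow> bool" where
  "injective_module _ _ R E \<longleftrightarrow>
    left_module R E \<and>
    (\<forall>(A :: ('r, 'a) module) (B :: ('r, 'b) module) f g.
      left_module R A \<and> left_module R B \<and>
      f \<in> module_homs R A B \<and> inj_on f (carrier A) \<and> g \<in> module_homs R A E \<longrightarrow>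
      (\<exists>h\<in>module_homs R B E. \<forall>x\<in>carrier A. h (f x) = g x))"

definition essential_submodule ::
    "('r, 's) ring_scheme \<Rightarrow> 'e set \<Rightarrow> ('r, 'e) module \<Rightarrow> bool" where
  "essential_submodule R H E \<longleftrightarrow>
    submodule H R E \<and>
    (\<forall>N. submodule N R E \<and> N \<noteq> {\<zero>\<^bsub>E\<^esub>} \<longrightarrow> N \<inter> H \<noteq> {\<zero>\<^bsub>E\<^esub>})"

text \<open>The module \<open>E\<close>, together with the embedding \<open>i\<close>, is an injective envelope of \<open>M\<close>.\<close>

definition injective_envelope ::
    "'a itself \<Rightarrow> 'b itself \<Rightarrow> ('r, 's) ring_scheme \<Rightarrow> ('r, 'm) module \<Rightarrow> ('r, 'e) module
      \<Rightarrow> ('m \<Rightarrow> 'e) \<Rightarrow> bool" where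
  "injective_envelope ta tb R M E i \<longleftrightarrow>
    left_module R M \<and> injective_module ta tb R E \<and>
    i \<in> module_homs R M E \<and> inj_on i (carrier M) \<and>
    essential_submodule R (i ` carrier M) E"


section \<open>The Leavitt path algebra\<close>

datatype generator = gv | gw | gc | gd | gc_star | gd_star

text \<open>
  The free unital associative algebra is the monoid algebra of the free monoid. Words are wrapped in a
  type of their own because the convolution product of \<^theory>\<open>HOL-Library.Poly_Mapping\<close> wants the
  monoid operation (here concatenation) to be written additively.
\<close>

datatype word = Word (letters: "generator list")

instantiation word :: monoid_add
begin
definition zero_word :: word where "zero_word = Word []"
definition plus_word :: "word \<Rightarrow> word \<Rightarrow> word" where "x + y = Word (letters x @ letters y)"
instance by standard (auto simp: zero_word_def plus_word_def)
end

type_synonym 'k free_algebra = "word \<Rightarrow>\<^sub>0 'k"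

definition gen :: "generator \<Rightarrow> 'k::field free_algebra" where
  "gen g = Poly_Mapping.single (Word [g]) 1"

definition relators :: "'k::field free_algebra set" where
  "relators =
    (let v = gen gv; w = gen gw; c = gen gc; d = gen gd; c' = gen gc_star; d' = gen gd_star in
     {v * v - v, w * w - w, v * w, w * v, v + w - 1,
      c - v * c, c - c * v, c' - v * c', c' - c' * v,
      d - v * d, d - d * w, d' - w * d', d' - d' * v,
      c' * c - v, d' * d - w, c' * d, d' * c, c * c' + d * d' - v})"

abbreviation free_ring :: "'k::field free_algebra ring" where
  "free_ring \<equiv> ring_of_type_algebra"

definition relator_ideal :: "'k::field free_algebra set" where
  "relator_ideal = Idl\<^bsub>free_ring\<^esub> relators"

definition leavitt :: "'k::field free_algebra set ring" where
  "leavitt = free_ring Quot relator_ideal"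

definition residue :: "'k::field free_algebra \<Rightarrow> 'k free_algebra set" where
  "residue p = relator_ideal +>\<^bsub>free_ring\<^esub> p"

definition left_ideal_w :: "('k::field free_algebra set, 'k free_algebra set) module" where
  "left_ideal_w =
    \<lparr>carrier = {r \<otimes>\<^bsub>leavitt\<^esub> residue (gen gw) | r. r \<in> carrier leavitt},
     monoid.mult = undefined, one = undefined,
     zero = \<zero>\<^bsub>leavitt\<^esub>, add = (\<oplus>\<^bsub>leavitt\<^esub>), module.smult = (\<otimes>\<^bsub>leavitt\<^esub>)\<rparr>"


section \<open>The module of formal series\<close>

text \<open>
  \<open>W\<close> stands for \<open>w\<close> and \<open>CD i\<close> for \<open>c\<^sup>i d\<close>. A function \<open>y\<close> is the series with coefficients
  \<open>k\<^sub>-\<^sub>1 = y W\<close> and \<open>k\<^sub>i = y (CD i)\<close>.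
\<close>

datatype index = W | CD nat

type_synonym 'k series = "index \<Rightarrow> 'k"

fun gen_act :: "generator \<Rightarrow> 'k::field series \<Rightarrow> 'k series" where
  "gen_act gv y = (\<lambda>b. case b of W \<Rightarrow> 0 | CD i \<Rightarrow> y (CD i))"
| "gen_act gw y = (\<lambda>b. case b of W \<Rightarrow> y W | CD i \<Rightarrow> 0)"
| "gen_act gc y = (\<lambda>b. case b of W \<Rightarrow> 0 | CD 0 \<Rightarrow> 0 | CD (Suc i) \<Rightarrow> y (CD i))"
| "gen_act gc_star y = (\<lambda>b. case b of W \<Rightarrow> 0 | CD i \<Rightarrow> y (CD (Suc i)))"
| "gen_act gd y = (\<lambda>b. case b of W \<Rightarrow> 0 | CD 0 \<Rightarrow> y W | CD (Suc i) \<Rightarrow> 0)"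
| "gen_act gd_star y = (\<lambda>b. case b of W \<Rightarrow> y (CD 0) | CD i \<Rightarrow> 0)"

definition word_act :: "word \<Rightarrow> 'k::field series \<Rightarrow> 'k series" where
  "word_act u y = foldr gen_act (letters u) y"

definition free_act :: "'k::field free_algebra \<Rightarrow> 'k series \<Rightarrow> 'k series" where
  "free_act p y =
    (\<lambda>b. \<Sum>u\<in>Poly_Mapping.keys p. Poly_Mapping.lookup p u * word_act u y b)"

text \<open>
  The action of a residue class is that of any representative; independence of the representative is
  lemma \<open>smult_residue\<close> below.
\<close>

definition series_module :: "('k::field free_algebra set, 'k series) module" where
  "series_module =
    \<lparr>carrier = UNIV, monoid.mult = undefined, one = undefined,
     zero = (\<lambda>b. 0), add = (\<lambda>y z b. y b + z b),
     module.smult = (\<lambda>r y. the_elem ((\<lambda>p. free_act p y) ` r))\<rparr>"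

definition series_of :: "index \<Rightarrow> 'k::field series" where
  "series_of b = (\<lambda>b'. if b' = b then 1 else 0)"

text \<open>
  The identification of the left ideal generated by \<open>w\<close> with the finite series: an element \<open>r = r w\<close>
  goes to \<open>r \<cdot> w\<close>. The lemmas \<open>ideal_embed_w\<close>, \<open>ideal_embed_c_d\<close> and
  \<open>ideal_embed_image\<close> below show that this is the evident map on the monomials \<open>w\<close> and
  \<open>c\<^sup>i d\<close>, and that its image is the set of finite series.
\<close>

definition ideal_embed :: "'k::field free_algebra set \<Rightarrow> 'k series" where
  "ideal_embed r = r \<odot>\<^bsub>series_module\<^esub> series_of W"


section \<open>The action is well defined\<close>

lemma word_act_0: "word_act 0 y = y"
  by (simp add: word_act_def zero_word_def)

lemma word_act_plus: "word_act (u + v) y = word_act u (word_act v y)"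
  by (simp add: word_act_def plus_word_def)

lemma gen_act_add: "gen_act g (\<lambda>b. y b + z b) = (\<lambda>b. gen_act g y b + gen_act g z b)"
  by (cases g) (auto simp: fun_eq_iff split: index.split nat.split)

lemma gen_act_scale: "gen_act g (\<lambda>b. a * y b) = (\<lambda>b. a * gen_act g y b)"
  by (cases g) (auto simp: fun_eq_iff split: index.split nat.split)

lemma word_act_add: "word_act u (\<lambda>b. y b + z b) = (\<lambda>b. word_act u y b + word_act u z b)"
proof -
  have "foldr gen_act us (\<lambda>b. y b + z b) = (\<lambda>b. foldr gen_act us y b + foldr gen_act us z b)" for us
    by (induction us) (simp_all add: gen_act_add)
  then show ?thesis by (simp add: word_act_def)
qed

lemma word_act_scale: "word_act u (\<lambda>b. a * y b) = (\<lambda>b. a * word_act u y b)"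
proof -
  have "foldr gen_act us (\<lambda>b. a * y b) = (\<lambda>b. a * foldr gen_act us y b)" for us
    by (induction us) (simp_all add: gen_act_scale)
  then show ?thesis by (simp add: word_act_def)
qed

lemma free_act_superset:
  assumes "finite S" "Poly_Mapping.keys p \<subseteq> S"
  shows "free_act p y b = (\<Sum>u\<in>S. Poly_Mapping.lookup p u * word_act u y b)"
  unfolding free_act_def
  by (rule sum.mono_neutral_left) (use assms in \<open>auto simp: in_keys_iff\<close>)

lemma free_act_0 [simp]: "free_act 0 y = (\<lambda>b. 0)"
  by (simp add: free_act_def)

lemma free_act_single: "free_act (Poly_Mapping.single u a) y = (\<lambda>b. a * word_act u y b)"
  by (auto simp: free_act_def)

lemma free_act_plus: "free_act (p + q) y = (\<lambda>b. free_act p y b + free_act q y b)"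
proof
  fix b
  let ?S = "Poly_Mapping.keys p \<union> Poly_Mapping.keys q"
  have "Poly_Mapping.keys (p + q) \<subseteq> ?S" by (rule Poly_Mapping.keys_add)
  then show "free_act (p + q) y b = free_act p y b + free_act q y b"
    by (simp add: free_act_superset[of ?S] lookup_add distrib_right sum.distrib)
qed

lemma free_act_uminus: "free_act (- p) y = (\<lambda>b. - free_act p y b)"
proof -
  have "(\<lambda>b. free_act (- p) y b + free_act p y b) = (\<lambda>b. 0)"
    using free_act_plus[of "- p" p y] by simp
  then show ?thesis by (auto simp: fun_eq_iff eq_neg_iff_add_eq_0)
qed

lemma free_act_minus: "free_act (p - q) y = (\<lambda>b. free_act p y b - free_act q y b)"
  using free_act_plus[of p "- q" y] by (simp add: free_act_uminus)

lemma free_act_one: "free_act 1 y = y"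
  using free_act_single[of 0 1 y] by (simp add: word_act_0)

lemma free_act_add: "free_act p (\<lambda>b. y b + z b) = (\<lambda>b. free_act p y b + free_act p z b)"
  by (simp add: free_act_def word_act_add distrib_left sum.distrib)

lemma free_act_scale: "free_act p (\<lambda>b. a * y b) = (\<lambda>b. a * free_act p y b)"
  by (simp add: free_act_def word_act_scale sum_distrib_left mult.left_commute)

lemma sum_monomials:
  "(\<Sum>u\<in>Poly_Mapping.keys p. Poly_Mapping.single u (Poly_Mapping.lookup p u)) = p"
  by (rule poly_mapping_eqI) (auto simp: lookup_sum lookup_single when_def in_keys_iff)

lemma free_algebra_induct [case_names zero single plus]:
  assumes "P 0" "\<And>u a. P (Poly_Mapping.single u a)" "\<And>p q. P p \<Longrightarrow> P q \<Longrightarrow> P (p + q)"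
  shows "P (p :: 'k::field free_algebra)"
proof -
  have "P (\<Sum>u\<in>S. Poly_Mapping.single u (Poly_Mapping.lookup p u))" if "finite S" for S
    using that by (induction S) (auto intro: assms)
  then show ?thesis
    using sum_monomials[of p] by (metis finite_keys)
qed

lemma free_act_times: "free_act (p * q) y = free_act p (free_act q y)"
proof (induction p rule: free_algebra_induct)
  case zero
  show ?case by simp
next
  case (plus p p')
  then show ?case by (simp add: distrib_right free_act_plus)
next
  case (single u a)
  show ?case
  proof (induction q rule: free_algebra_induct)
    case zero
    have "free_act (Poly_Mapping.single u a) (\<lambda>b. 0 * y b) = (\<lambda>b. 0)"
      by (simp only: free_act_scale) simp
    then show ?case by simp
  next
    case (plus q q')
    then show ?case by (simp add: distrib_left free_act_plus free_act_add)
  next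
    case (single v a')
    show ?case
      by (simp add: mult_single free_act_single word_act_plus word_act_scale mult.assoc)
  qed
qed

lemma free_act_gen [simp]: "free_act (gen g) y = gen_act g y"
  by (simp add: gen_def free_act_single word_act_def)

lemma relator_act:
  assumes "p \<in> relators"
  shows "free_act p y = (\<lambda>b. 0)"
  using assms
  by (auto simp: relators_def Let_def free_act_minus free_act_plus free_act_times free_act_one
      fun_eq_iff split: index.split nat.split)

lemma free_ring_simps [simp]:
  "carrier free_ring = UNIV" "x \<otimes>\<^bsub>free_ring\<^esub> y = x * y" "x \<oplus>\<^bsub>free_ring\<^esub> y = x + y"
  "\<zero>\<^bsub>free_ring\<^esub> = 0" "\<one>\<^bsub>free_ring\<^esub> = 1"
  by (simp_all add: ring_of_type_algebra_def)

lemma ring_free_ring: "ring (free_ring :: 'k::field free_algebra ring)"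
proof (rule ringI)
  show "abelian_group (free_ring :: 'k free_algebra ring)"
    by (rule abelian_groupI) (auto simp: ac_simps intro: exI[of _ "- x" for x])
  show "Group.monoid (free_ring :: 'k free_algebra ring)"
    by (rule monoidI) (auto simp: ac_simps)
qed (auto simp: algebra_simps)

lemma relator_ideal_ideal: "ideal relator_ideal free_ring"
  unfolding relator_ideal_def by (rule ring.genideal_ideal[OF ring_free_ring]) simp

lemma ring_leavitt: "ring leavitt"
  unfolding leavitt_def by (rule ideal.quotient_is_ring[OF relator_ideal_ideal])

lemma relator_ideal_act:
  assumes "(p :: 'a::field free_algebra) \<in> relator_ideal"
  shows "free_act p y = (\<lambda>b. 0)"
proof -
  let ?J = "{p :: 'a free_algebra. \<forall>y. free_act p y = (\<lambda>b. 0)}"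
  have z: "free_act p (\<lambda>b. 0) = (\<lambda>b. 0)" for p :: "'a free_algebra"
    using free_act_scale[of p 0 y] by simp
  have "ideal ?J (free_ring :: 'a free_algebra ring)"
  proof (rule idealI[OF ring_free_ring])
    show "subgroup ?J (add_monoid (free_ring :: 'a free_algebra ring))"
    proof (rule group.subgroupI)
      show "group (add_monoid (free_ring :: 'a free_algebra ring))"
        by (rule abelian_group.a_group[OF ring.is_abelian_group[OF ring_free_ring]])
      show "?J \<noteq> {}" by (auto intro!: exI[of _ 0])
      show "a \<in> ?J \<Longrightarrow> inv\<^bsub>add_monoid free_ring\<^esub> a \<in> ?J" for a
      proof -
        assume a: "a \<in> ?J"
        have "inv\<^bsub>add_monoid free_ring\<^esub> a = - a"
          using abelian_group.minus_equality[OF ring.is_abelian_group[OF ring_free_ring], of "- a" a]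
          by (simp add: a_inv_def)
        with a show ?thesis by (simp add: free_act_uminus)
      qed
    qed (auto simp: free_act_plus)
  qed (auto simp: free_act_times z)
  moreover have "relators \<subseteq> ?J" using relator_act by fast
  ultimately have "relator_ideal \<subseteq> ?J"
    unfolding relator_ideal_def by (rule ring.genideal_minimal[OF ring_free_ring])
  with assms show ?thesis by auto
qed

lemma residue_eq: "residue p = {q + p | q. q \<in> relator_ideal}"
  by (auto simp: residue_def a_r_coset_def')

lemma smult_residue: "residue p \<odot>\<^bsub>series_module\<^esub> y = free_act p y"
proof -
  have "0 \<in> (relator_ideal :: 'a free_algebra set)"
    using additive_subgroup.zero_closed[OF ideal.axioms(1)[OF relator_ideal_ideal]] by simp
  then have "(\<lambda>p. free_act p y) ` residue p = {free_act p y}"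
    by (force simp: residue_eq free_act_plus relator_ideal_act)
  then show ?thesis by (simp add: series_module_def)
qed

lemma carrier_leavitt: "carrier leavitt = range residue"
  by (auto simp: leavitt_def FactRing_def A_RCOSETS_def' residue_def)

lemma leavitt_mult: "residue p \<otimes>\<^bsub>leavitt\<^esub> residue q = residue (p * q)"
  using ideal.rcoset_mult_add[OF relator_ideal_ideal, of p q]
  by (simp add: leavitt_def FactRing_def residue_def)

lemma leavitt_add: "residue p \<oplus>\<^bsub>leavitt\<^esub> residue q = residue (p + q)"
proof -
  interpret ideal relator_ideal "free_ring :: 'a free_algebra ring"
    by (rule relator_ideal_ideal)
  show ?thesis using a_rcos_sum[of p q] by (simp add: leavitt_def FactRing_def residue_def)
qed

lemma leavitt_one: "\<one>\<^bsub>leavitt\<^esub> = residue 1"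
  by (simp add: leavitt_def FactRing_def residue_def)

lemma left_module_series: "left_module leavitt series_module"
proof -
  have sm: "carrier series_module = UNIV"
    "\<And>y z :: 'a series. y \<oplus>\<^bsub>series_module\<^esub> z = (\<lambda>b. y b + z b)"
    "\<zero>\<^bsub>series_module\<^esub> = (\<lambda>b. 0 :: 'a)"
    by (simp_all add: series_module_def)
  have "abelian_group (series_module :: ('a free_algebra set, 'a series) module)"
  proof (rule abelian_groupI)
    fix x :: "'a series"
    show "\<exists>y\<in>carrier series_module. y \<oplus>\<^bsub>series_module\<^esub> x = \<zero>\<^bsub>series_module\<^esub>"
      by (rule bexI[of _ "\<lambda>b. - x b"]) (simp_all add: sm)
  qed (simp_all add: sm ac_simps)
  then show ?thesis
    by (intro left_module.intro ring_leavitt left_module_axioms.intro)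
      (auto simp: sm carrier_leavitt leavitt_mult leavitt_add leavitt_one smult_residue
        free_act_plus free_act_add free_act_times free_act_one)
qed

section \<open>The embedding of the left ideal\<close>

lemma carrier_left_ideal_w: "carrier left_ideal_w = range (\<lambda>p. residue (p * gen gw))"
proof -
  have "carrier left_ideal_w = (\<lambda>r. r \<otimes>\<^bsub>leavitt\<^esub> residue (gen gw)) ` carrier leavitt"
    by (auto simp: left_ideal_w_def)
  then show ?thesis by (simp add: carrier_leavitt image_image leavitt_mult)
qed

lemma ideal_embed_w: "ideal_embed (residue (gen gw)) = series_of W"
  by (auto simp: ideal_embed_def smult_residue series_of_def fun_eq_iff split: index.split)

lemma ideal_embed_c_d:
  "ideal_embed (residue (gen gc ^ i * gen gd)) = (series_of (CD i) :: 'a::field series)"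
proof -
  have "free_act (gen gc ^ i) (series_of (CD j)) = (series_of (CD (i + j)) :: 'a series)" for j
    by (induction i arbitrary: j)
      (auto simp: free_act_one free_act_times series_of_def fun_eq_iff split: index.split nat.split)
  moreover have "gen_act gd (series_of W) = (series_of (CD 0) :: 'a series)"
    by (auto simp: series_of_def fun_eq_iff split: index.split nat.split)
  ultimately show ?thesis
    by (simp add: ideal_embed_def smult_residue free_act_times del: gen_act.simps)
qed

lemma finite_support_iff:
  "finite {b. y b \<noteq> 0} \<longleftrightarrow> (\<exists>N. \<forall>i\<ge>N. y (CD i) = 0)" for y :: "'a::field series"
proof
  assume "finite {b. y b \<noteq> 0}"
  then have "finite (CD -` {b. y b \<noteq> 0})"
    by (rule finite_vimageI) (simp add: inj_def)
  then obtain N where "CD -` {b. y b \<noteq> 0} \<subseteq> {..<N}"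
    by (meson finite_nat_iff_bounded)
  then have "\<forall>i\<ge>N. y (CD i) = 0"
    by (auto simp: subset_iff not_le[symmetric])
  then show "\<exists>N. \<forall>i\<ge>N. y (CD i) = 0" ..
next
  assume "\<exists>N. \<forall>i\<ge>N. y (CD i) = 0"
  then obtain N where N: "y (CD i) = 0" if "i \<ge> N" for i by blast
  have "b \<in> insert W (CD ` {..<N})" if "y b \<noteq> 0" for b
    using that N by (cases b) (auto simp: image_iff, meson not_le)
  then have "{b. y b \<noteq> 0} \<subseteq> insert W (CD ` {..<N})" by blast
  then show "finite {b. y b \<noteq> 0}" by (rule finite_subset) simp
qed

lemma ideal_embed_image: "ideal_embed ` carrier left_ideal_w = {y. finite {b. y b \<noteq> 0}}"
proof
  have fin_gen: "finite {b. gen_act g y b \<noteq> 0}" if "finite {b. y b \<noteq> 0}" for g and y :: "'a series"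
  proof -
    obtain N where N: "y (CD i) = 0" if "i \<ge> N" for i
      using \<open>finite {b. y b \<noteq> 0}\<close> by (auto simp: finite_support_iff)
    have "gen_act g y (CD i) = 0" if "i \<ge> Suc N" for i
      using that by (cases g; cases i) (auto intro: N)
    then show ?thesis by (auto simp: finite_support_iff simp del: gen_act.simps)
  qed
  have word: "finite {b. word_act u y b \<noteq> 0}" if "finite {b. y b \<noteq> 0}" for u and y :: "'a series"
  proof -
    have "finite {b. foldr gen_act us y b \<noteq> 0}" for us
      by (induction us) (simp_all add: that fin_gen)
    then show ?thesis by (simp add: word_act_def)
  qed
  have free: "finite {b. free_act p y b \<noteq> 0}" if "finite {b. y b \<noteq> 0}" for p and y :: "'a series"
  proof (induction p rule: free_algebra_induct)
    case (single u a)
    show ?case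
      by (rule finite_subset[OF _ word[OF that, of u]]) (auto simp: free_act_single)
  next
    case (plus p q)
    have "{b. free_act (p + q) y b \<noteq> 0} \<subseteq> {b. free_act p y b \<noteq> 0} \<union> {b. free_act q y b \<noteq> 0}"
      by (auto simp: free_act_plus)
    then show ?case using plus by (meson finite_UnI finite_subset)
  qed simp
  show "ideal_embed ` carrier left_ideal_w \<subseteq> {y :: 'a series. finite {b. y b \<noteq> 0}}"
    by (auto simp: carrier_left_ideal_w ideal_embed_def smult_residue free_act_times series_of_def
        intro!: free fin_gen simp del: gen_act.simps)
next
  show "{y :: 'a series. finite {b. y b \<noteq> 0}} \<subseteq> ideal_embed ` carrier left_ideal_w"
  proof (intro subsetI, clarify)
    fix y :: "'a series" assume fin: "finite {b. y b \<noteq> 0}"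
    have w: "gen_act gw (series_of W) = (series_of W :: 'a series)"
      by (auto simp: series_of_def fun_eq_iff split: index.split)
    have mono: "\<exists>p. free_act p (series_of W) = (series_of b :: 'a series)" for b
    proof (cases b)
      case W
      then show ?thesis using w by (metis free_act_gen)
    next
      case (CD i)
      then show ?thesis using ideal_embed_c_d[of i] by (metis ideal_embed_def smult_residue)
    qed
    have "\<exists>p. free_act p (series_of W) = (\<lambda>b'. \<Sum>b\<in>S. y b * series_of b b')" if "finite S" for S
      using that
    proof (induction S)
      case empty
      show ?case by (auto intro: exI[of _ 0])
    next
      case (insert b S)
      obtain p where p: "free_act p (series_of W) = (\<lambda>b'. \<Sum>b\<in>S. y b * series_of b b')"
        using insert.IH by blast
      obtain q where q: "free_act q (series_of W) = (series_of b :: 'a series)"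
        using mono by blast
      have "free_act (Poly_Mapping.single 0 (y b) * q + p) (series_of W)
          = (\<lambda>b'. \<Sum>b\<in>insert b S. y b * series_of b b')"
        using insert.hyps
        by (simp add: free_act_plus free_act_times free_act_single word_act_0 p q)
      then show ?case by blast
    qed
    then obtain p where p:
      "free_act p (series_of W) = (\<lambda>b'. \<Sum>b\<in>{b. y b \<noteq> 0}. y b * series_of b b')"
      using fin by blast
    have "(\<Sum>b\<in>{b. y b \<noteq> 0}. y b * series_of b b') = y b'" for b'
    proof -
      have "(\<Sum>b\<in>{b. y b \<noteq> 0}. y b * series_of b b')
          = (\<Sum>b\<in>{b. y b \<noteq> 0}. if b' = b then y b else 0)"
        by (rule sum.cong) (auto simp: series_of_def)
      also have "\<dots> = y b'" using fin by (simp add: sum.delta')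
      finally show ?thesis .
    qed
    then have "free_act p (series_of W) = y" by (simp only: p)
    then have "ideal_embed (residue (p * gen gw)) = y"
      by (simp add: ideal_embed_def smult_residue free_act_times w del: gen_act.simps)
    then show "y \<in> ideal_embed ` carrier left_ideal_w"
      by (auto simp: carrier_left_ideal_w)
  qed
qed

end

theory Submission
  imports Defs
begin

text \<open>
  The elements \<open>w\<close> and \<open>d\<^sup>* (c\<^sup>*)\<^sup>i\<close>, called rows below, span the right ideal \<open>w R\<close>, and row \<open>b\<close>
  sends a series to its coefficient at \<open>b\<close>, times \<open>w\<close> (\<open>free_act_row\<close>). Through this pairing \<open>Y\<close> is
  the dual space \<open>Hom\<^sub>K (w R, K)\<close>, with \<open>R\<close> acting on the left by right multiplication inside the
  argument; everything about \<open>Y\<close> follows from that description.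

  Injectivity. A homomorphism from a left module \<open>A\<close> to \<open>Hom\<^sub>K (w R, K)\<close> is the same thing as a
  \<open>K\<close>-linear functional on \<open>w A\<close>: the homomorphism \<open>g\<close> corresponds to the coefficient of \<open>w\<close> in \<open>g x\<close>.
  Extending homomorphisms along an embedding of \<open>A\<close> into \<open>B\<close> thus amounts to extending linear
  functionals, which is possible because vector spaces are injective (\<open>vector_space_injective\<close>, by
  Zorn's lemma). It is convenient to extend to a functional \<open>\<mu>\<close> on all of \<open>B\<close>; then
  \<open>x \<mapsto> (b \<mapsto> \<mu> (row b \<cdot> x))\<close> is \<open>R\<close>-linear (\<open>coinduced_hom\<close>), because multiplying rows by generators
  from the right (\<open>row_times_gen\<close>) is transpose to the action on series.

  The left ideal. The columns \<open>w\<close> and \<open>c\<^sup>i d\<close> span \<open>R w\<close>, since the relations turn the product of a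
  generator and a column into a column or \<open>0\<close>; they act on \<open>w \<in> Y\<close> to give the distinct unit series.
  Hence an element of \<open>R w\<close> can be reconstructed from its image in \<open>Y\<close> (\<open>residue_eq_combination\<close>), so
  \<open>R w\<close> embeds.

  Simplicity and essentiality. If a series has a nonzero coefficient at \<open>b\<close>, row \<open>b\<close> followed by a
  scalar takes it to \<open>w\<close> (\<open>ex_free_act_eq_w\<close>). So each nonzero submodule of \<open>R w\<close> or of \<open>Y\<close> contains
  \<open>w\<close>.
\<close>


section \<open>Vector spaces are injective\<close>

lemma left_module_imp_module: "cring R \<Longrightarrow> left_module R M \<Longrightarrow> module R M"
  by (auto simp: left_module_def left_module_axioms_def module_def module_axioms_def)

lemma module_homsD:
  assumes "f \<in> module_homs R M N"
  shows "x \<in> carrier M \<Longrightarrow> f x \<in> carrier N"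
    and "x \<in> carrier M \<Longrightarrow> y \<in> carrier M \<Longrightarrow> f (x \<oplus>\<^bsub>M\<^esub> y) = f x \<oplus>\<^bsub>N\<^esub> f y"
    and "r \<in> carrier R \<Longrightarrow> x \<in> carrier M \<Longrightarrow> f (r \<odot>\<^bsub>M\<^esub> x) = r \<odot>\<^bsub>N\<^esub> f x"
  using assms by (auto simp: module_homs_def hom_def)

lemma module_homsI:
  assumes "\<And>x. x \<in> carrier M \<Longrightarrow> f x \<in> carrier N"
    and "\<And>x y. x \<in> carrier M \<Longrightarrow> y \<in> carrier M \<Longrightarrow> f (x \<oplus>\<^bsub>M\<^esub> y) = f x \<oplus>\<^bsub>N\<^esub> f y"
    and "\<And>r x. r \<in> carrier R \<Longrightarrow> x \<in> carrier M \<Longrightarrow> f (r \<odot>\<^bsub>M\<^esub> x) = r \<odot>\<^bsub>N\<^esub> f x"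
  shows "f \<in> module_homs R M N"
  using assms by (auto simp: module_homs_def hom_def)

text \<open>
  A graph of a linear map defined on a subspace of \<open>M\<close>, given by its closure properties. Only
  uniqueness of the value at \<open>0\<close> is demanded, since closure then yields uniqueness everywhere; the
  conditions are stable under unions of chains.
\<close>

definition linear_graph ::
    "('r, 's) ring_scheme \<Rightarrow> ('r, 'm) module \<Rightarrow> ('r, 'n) module \<Rightarrow> ('m \<times> 'n) set \<Rightarrow> bool" where
  "linear_graph F M N G \<longleftrightarrow>
    G \<subseteq> carrier M \<times> carrier N \<and>
    (\<forall>x a y b. (x, a) \<in> G \<longrightarrow> (y, b) \<in> G \<longrightarrow> (x \<oplus>\<^bsub>M\<^esub> y, a \<oplus>\<^bsub>N\<^esub> b) \<in> G) \<and>
    (\<forall>k\<in>carrier F. \<forall>x a. (x, a) \<in> G \<longrightarrow> (k \<odot>\<^bsub>M\<^esub> x, k \<odot>\<^bsub>N\<^esub> a) \<in> G) \<and>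
    (\<forall>a. (\<zero>\<^bsub>M\<^esub>, a) \<in> G \<longrightarrow> a = \<zero>\<^bsub>N\<^esub>)"

lemma linear_graphD:
  assumes "linear_graph F M N G"
  shows "(x, a) \<in> G \<Longrightarrow> x \<in> carrier M" "(x, a) \<in> G \<Longrightarrow> a \<in> carrier N"
    "(x, a) \<in> G \<Longrightarrow> (y, b) \<in> G \<Longrightarrow> (x \<oplus>\<^bsub>M\<^esub> y, a \<oplus>\<^bsub>N\<^esub> b) \<in> G"
    "k \<in> carrier F \<Longrightarrow> (x, a) \<in> G \<Longrightarrow> (k \<odot>\<^bsub>M\<^esub> x, k \<odot>\<^bsub>N\<^esub> a) \<in> G"
    "(\<zero>\<^bsub>M\<^esub>, a) \<in> G \<Longrightarrow> a = \<zero>\<^bsub>N\<^esub>"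
  using assms unfolding linear_graph_def by blast+

lemma linear_graph_single_valued:
  assumes M: "module F M" and N: "module F N" and G: "linear_graph F M N G"
    and xa: "(x, a) \<in> G" and xb: "(x, b) \<in> G"
  shows "a = b"
proof -
  interpret M: module F M by (rule M)
  interpret N: module F N by (rule N)
  note D = linear_graphD[OF G]
  have "(x \<oplus>\<^bsub>M\<^esub> (\<ominus>\<^bsub>F\<^esub> \<one>\<^bsub>F\<^esub>) \<odot>\<^bsub>M\<^esub> x, a \<oplus>\<^bsub>N\<^esub> (\<ominus>\<^bsub>F\<^esub> \<one>\<^bsub>F\<^esub>) \<odot>\<^bsub>N\<^esub> b) \<in> G"
    using xa xb by (intro D) auto
  then have "(\<zero>\<^bsub>M\<^esub>, a \<oplus>\<^bsub>N\<^esub> \<ominus>\<^bsub>N\<^esub> b) \<in> G"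
    using D(1,2)[OF xa] D(1,2)[OF xb]
    by (simp add: M.smult_l_minus N.smult_l_minus M.M.r_neg)
  from D(5)[OF this] show ?thesis
    using D(2)[OF xa] D(2)[OF xb] by (metis N.M.minus_equality N.M.minus_minus N.M.a_inv_closed)
qed

text \<open>
  The step that a maximal graph cannot admit: on the span of the old domain and \<open>z\<close>, the new map is
  zero on \<open>z\<close>. Were it to take a nonzero value at \<open>0 = x + k z\<close>, then \<open>k\<close> would be nonzero, and
  dividing by it would place \<open>z\<close> in the old domain.
\<close>

lemma linear_graph_extend:
  assumes F: "field F" and M: "module F M" and N: "module F N" and G: "linear_graph F M N G"
    and zero: "(\<zero>\<^bsub>M\<^esub>, \<zero>\<^bsub>N\<^esub>) \<in> G" and z: "z \<in> carrier M" "z \<notin> Domain G"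
  shows "\<exists>G'. linear_graph F M N G' \<and> G \<subseteq> G' \<and> z \<in> Domain G'"
proof -
  interpret F: field F by (rule F)
  interpret M: module F M by (rule M)
  interpret N: module F N by (rule N)
  note D = linear_graphD[OF G]
  define G' where "G' = {(x \<oplus>\<^bsub>M\<^esub> k \<odot>\<^bsub>M\<^esub> z, a) | x a k. (x, a) \<in> G \<and> k \<in> carrier F}"
  have G'I: "(y, a) \<in> G'" if "(x, a) \<in> G" "k \<in> carrier F" "y = x \<oplus>\<^bsub>M\<^esub> k \<odot>\<^bsub>M\<^esub> z" for x y a k
    using that by (auto simp: G'_def)
  have "linear_graph F M N G'"
    unfolding linear_graph_def
  proof (intro conjI allI ballI impI)
    show "G' \<subseteq> carrier M \<times> carrier N"
      using D(1,2) z by (auto simp: G'_def)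
  next
    fix x a y b assume "(x, a) \<in> G'" "(y, b) \<in> G'"
    then obtain x' k y' l where *: "(x', a) \<in> G" "k \<in> carrier F" "x = x' \<oplus>\<^bsub>M\<^esub> k \<odot>\<^bsub>M\<^esub> z"
      "(y', b) \<in> G" "l \<in> carrier F" "y = y' \<oplus>\<^bsub>M\<^esub> l \<odot>\<^bsub>M\<^esub> z"
      by (auto simp: G'_def)
    show "(x \<oplus>\<^bsub>M\<^esub> y, a \<oplus>\<^bsub>N\<^esub> b) \<in> G'"
      by (rule G'I[OF D(3)[OF *(1,4)], of "k \<oplus>\<^bsub>F\<^esub> l"])
        (use * z D(1)[OF *(1)] D(1)[OF *(4)] in \<open>simp_all add: M.smult_l_distr M.M.a_ac\<close>)
  next
    fix k x a assume k: "k \<in> carrier F" and "(x, a) \<in> G'"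
    then obtain x' l where *: "(x', a) \<in> G" "l \<in> carrier F" "x = x' \<oplus>\<^bsub>M\<^esub> l \<odot>\<^bsub>M\<^esub> z"
      by (auto simp: G'_def)
    show "(k \<odot>\<^bsub>M\<^esub> x, k \<odot>\<^bsub>N\<^esub> a) \<in> G'"
      by (rule G'I[OF D(4)[OF k *(1)], of "k \<otimes>\<^bsub>F\<^esub> l"])
        (use * k z D(1)[OF *(1)] in \<open>simp_all add: M.smult_r_distr M.smult_assoc1\<close>)
  next
    fix a assume "(\<zero>\<^bsub>M\<^esub>, a) \<in> G'"
    then obtain x k where *: "(x, a) \<in> G" "k \<in> carrier F" "x \<oplus>\<^bsub>M\<^esub> k \<odot>\<^bsub>M\<^esub> z = \<zero>\<^bsub>M\<^esub>"
      by (auto simp: G'_def)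
    note x = D(1)[OF *(1)]
    have k0: "k = \<zero>\<^bsub>F\<^esub>"
    proof (rule ccontr)
      assume "k \<noteq> \<zero>\<^bsub>F\<^esub>"
      then have k: "k \<in> Units F" using *(2) F.field_Units by auto
      define l where "l = \<ominus>\<^bsub>F\<^esub> (inv\<^bsub>F\<^esub> k)"
      have l: "l \<in> carrier F" using k by (auto simp: l_def)
      have "x = \<ominus>\<^bsub>M\<^esub> (k \<odot>\<^bsub>M\<^esub> z)"
        using *(2,3) x z by (metis M.M.minus_equality M.smult_closed)
      then have "x = (\<ominus>\<^bsub>F\<^esub> k) \<odot>\<^bsub>M\<^esub> z"
        using *(2) z by (simp add: M.smult_l_minus)
      then have "l \<odot>\<^bsub>M\<^esub> x = (l \<otimes>\<^bsub>F\<^esub> (\<ominus>\<^bsub>F\<^esub> k)) \<odot>\<^bsub>M\<^esub> z"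
        using l *(2) z by (simp add: M.smult_assoc1)
      also have "l \<otimes>\<^bsub>F\<^esub> (\<ominus>\<^bsub>F\<^esub> k) = \<one>\<^bsub>F\<^esub>"
        using k by (simp add: l_def F.l_minus F.r_minus F.Units_closed)
      finally have "(z, l \<odot>\<^bsub>N\<^esub> a) \<in> G"
        using D(4)[OF l *(1)] z by simp
      with z(2) show False by auto
    qed
    show "a = \<zero>\<^bsub>N\<^esub>"
      using *(1,3) x z by (intro D(5)) (simp add: k0)
  qed
  moreover have "G \<subseteq> G'"
  proof (rule subrelI)
    fix x a assume xa: "(x, a) \<in> G"
    show "(x, a) \<in> G'"
      by (rule G'I[OF xa, of "\<zero>\<^bsub>F\<^esub>"]) (use z D(1)[OF xa] in auto)
  qed
  moreover have "(z, \<zero>\<^bsub>N\<^esub>) \<in> G'"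
    by (rule G'I[OF zero, of "\<one>\<^bsub>F\<^esub>"]) (use z in auto)
  ultimately show ?thesis by blast
qed

lemma linear_graph_Union:
  assumes "C \<noteq> {}" "subset.chain {G. linear_graph F M N G} C"
  shows "linear_graph F M N (\<Union>C)"
proof -
  have C: "linear_graph F M N G" if "G \<in> C" for G
    using assms(2) that by (auto simp: subset.chain_def)
  have join: "\<exists>G\<in>C. p \<in> G \<and> q \<in> G" if pq: "p \<in> \<Union>C" "q \<in> \<Union>C" for p q
  proof -
    obtain G H where GH: "G \<in> C" "H \<in> C" "p \<in> G" "q \<in> H" using pq by blast
    then have "G \<subseteq> H \<or> H \<subseteq> G" using assms(2) by (auto simp: subset_chain_def)
    with GH show ?thesis by blast
  qed
  show ?thesis
    unfolding linear_graph_def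
  proof (intro conjI allI ballI impI)
    show "\<Union>C \<subseteq> carrier M \<times> carrier N"
      using C unfolding linear_graph_def by blast
  next
    fix x a y b assume "(x, a) \<in> \<Union>C" "(y, b) \<in> \<Union>C"
    then obtain G where "G \<in> C" "(x, a) \<in> G" "(y, b) \<in> G" using join by blast
    then show "(x \<oplus>\<^bsub>M\<^esub> y, a \<oplus>\<^bsub>N\<^esub> b) \<in> \<Union>C"
      using linear_graphD(3)[OF C] by blast
  next
    fix k x a assume "k \<in> carrier F" "(x, a) \<in> \<Union>C"
    then show "(k \<odot>\<^bsub>M\<^esub> x, k \<odot>\<^bsub>N\<^esub> a) \<in> \<Union>C"
      using linear_graphD(4)[OF C] by blast
  next
    fix a assume "(\<zero>\<^bsub>M\<^esub>, a) \<in> \<Union>C"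
    then show "a = \<zero>\<^bsub>N\<^esub>" using linear_graphD(5)[OF C] by blast
  qed
qed

text \<open>
  The pairs \<open>(f x, g x)\<close> form a linear graph because \<open>f\<close> is injective. A maximal graph above it
  has full domain, and the map it describes extends \<open>g\<close> along \<open>f\<close>.
\<close>

lemma vector_space_injective:
  fixes F :: "('r, 's) ring_scheme" and E :: "('r, 'e) module"
  assumes F: "field F" and E: "left_module F E"
  shows "injective_module TYPE('a) TYPE('b) F E"
  unfolding injective_module_def
proof (intro conjI allI impI)
  fix A :: "('r, 'a) module" and B :: "('r, 'b) module" and f g
  assume "left_module F A \<and> left_module F B \<and>
    f \<in> module_homs F A B \<and> inj_on f (carrier A) \<and> g \<in> module_homs F A E"
  then have AM: "module F A" and BM: "module F B" and f: "f \<in> module_homs F A B"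
    and inj: "inj_on f (carrier A)" and g: "g \<in> module_homs F A E"
    by (auto intro: left_module_imp_module fieldE(1)[OF F])
  have EM: "module F E" by (rule left_module_imp_module[OF fieldE(1)[OF F] E])
  interpret A: module F A by (rule AM)
  interpret B: module F B by (rule BM)
  interpret E: module F E by (rule EM)
  note f = module_homsD[OF f] and g = module_homsD[OF g]
  have f0: "f \<zero>\<^bsub>A\<^esub> = \<zero>\<^bsub>B\<^esub>" and g0: "g \<zero>\<^bsub>A\<^esub> = \<zero>\<^bsub>E\<^esub>"
    using f(3)[OF A.R.zero_closed A.M.zero_closed] g(3)[OF A.R.zero_closed A.M.zero_closed] f(1) g(1)
    by simp_all
  define G0 where "G0 = (\<lambda>x. (f x, g x)) ` carrier A"
  have G0: "linear_graph F B E G0"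
    unfolding linear_graph_def
  proof (intro conjI allI ballI impI)
    fix a assume "(\<zero>\<^bsub>B\<^esub>, a) \<in> G0"
    then obtain x where x: "x \<in> carrier A" "f x = \<zero>\<^bsub>B\<^esub>" "a = g x" by (auto simp: G0_def)
    with f0 have "x = \<zero>\<^bsub>A\<^esub>" using inj by (metis A.M.zero_closed inj_onD)
    then show "a = \<zero>\<^bsub>E\<^esub>" using x g0 by simp
  next
    fix x a y b assume "(x, a) \<in> G0" "(y, b) \<in> G0"
    then obtain x' y' where *: "x' \<in> carrier A" "y' \<in> carrier A"
      "x = f x'" "a = g x'" "y = f y'" "b = g y'" by (auto simp: G0_def)
    show "(x \<oplus>\<^bsub>B\<^esub> y, a \<oplus>\<^bsub>E\<^esub> b) \<in> G0"
      unfolding G0_def by (rule image_eqI[of _ _ "x' \<oplus>\<^bsub>A\<^esub> y'"]) (use * in \<open>simp_all add: f g\<close>)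
  next
    fix k x a assume k: "k \<in> carrier F" and "(x, a) \<in> G0"
    then obtain x' where *: "x' \<in> carrier A" "x = f x'" "a = g x'" by (auto simp: G0_def)
    show "(k \<odot>\<^bsub>B\<^esub> x, k \<odot>\<^bsub>E\<^esub> a) \<in> G0"
      unfolding G0_def by (rule image_eqI[of _ _ "k \<odot>\<^bsub>A\<^esub> x'"]) (use k * in \<open>simp_all add: f g\<close>)
  qed (auto simp: G0_def f g)
  have zero: "(\<zero>\<^bsub>B\<^esub>, \<zero>\<^bsub>E\<^esub>) \<in> G0"
    using f0 g0 by (force simp: G0_def)
  let ?X = "{G. linear_graph F B E G \<and> G0 \<subseteq> G}"
  have "\<exists>G\<in>?X. \<forall>G'\<in>?X. G \<subseteq> G' \<longrightarrow> G' = G"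
  proof (rule subset_Zorn_nonempty)
    show "?X \<noteq> {}" using G0 by blast
    fix C assume C: "C \<noteq> {}" "subset.chain ?X C"
    then have "subset.chain {G. linear_graph F B E G} C" by (auto simp: subset.chain_def)
    then have "linear_graph F B E (\<Union>C)" by (rule linear_graph_Union[OF C(1)])
    moreover obtain G where "G \<in> C" using C(1) by blast
    ultimately show "\<Union>C \<in> ?X" using C(2) unfolding subset.chain_def by blast
  qed
  then obtain G where G: "linear_graph F B E G" "G0 \<subseteq> G"
    and max: "\<And>G'. linear_graph F B E G' \<Longrightarrow> G \<subseteq> G' \<Longrightarrow> G' = G"
    by (metis (mono_tags, lifting) mem_Collect_eq order_trans)
  note D = linear_graphD[OF G(1)]
  have total: "\<exists>a. (x, a) \<in> G" if "x \<in> carrier B" for x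
    using linear_graph_extend[OF F BM EM G(1) _ that] zero G(2) max by blast
  define h where "h x = (SOME a. (x, a) \<in> G)" for x
  have hG: "(x, h x) \<in> G" if "x \<in> carrier B" for x
    unfolding h_def by (rule someI_ex[OF total[OF that]])
  have h_eq: "h x = a" if "(x, a) \<in> G" for x a
    using linear_graph_single_valued[OF BM EM G(1) hG that] D(1)[OF that] by blast
  show "\<exists>h\<in>module_homs F B E. \<forall>x\<in>carrier A. h (f x) = g x"
  proof
    show "h \<in> module_homs F B E"
    proof (rule module_homsI)
      fix x y assume "x \<in> carrier B" "y \<in> carrier B"
      then show "h (x \<oplus>\<^bsub>B\<^esub> y) = h x \<oplus>\<^bsub>E\<^esub> h y" by (intro h_eq D(3) hG)
    next
      fix k x assume "k \<in> carrier F" "x \<in> carrier B"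
      then show "h (k \<odot>\<^bsub>B\<^esub> x) = k \<odot>\<^bsub>E\<^esub> h x" by (intro h_eq D(4) hG)
    qed (rule D(2)[OF hG])
    show "\<forall>x\<in>carrier A. h (f x) = g x"
      using G(2) by (auto simp: G0_def intro!: h_eq)
  qed
qed (rule E)

section \<open>Relations between residue classes\<close>

lemma residue_eq_iff: "residue p = residue q \<longleftrightarrow> p - q \<in> relator_ideal"
proof -
  interpret I: ideal relator_ideal "free_ring :: 'a::field free_algebra ring"
    by (rule relator_ideal_ideal)
  have uminus: "r \<in> relator_ideal \<Longrightarrow> - r \<in> relator_ideal" for r :: "'a free_algebra"
    using I.I_l_closed[of r "- 1"] by simp
  have plus: "r \<in> relator_ideal \<Longrightarrow> s \<in> relator_ideal \<Longrightarrow> r + s \<in> relator_ideal"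
    for r s :: "'a free_algebra"
    using additive_subgroup.a_closed[OF I.additive_subgroup_axioms, of r s] by simp
  show ?thesis
  proof
    assume eq: "residue p = residue q"
    have "p \<in> residue p" using additive_subgroup.zero_closed[OF I.additive_subgroup_axioms]
      by (force simp: residue_eq)
    with eq show "p - q \<in> relator_ideal" by (auto simp: residue_eq)
  next
    assume pq: "p - q \<in> relator_ideal"
    have "\<exists>s. r + p = s + q \<and> s \<in> relator_ideal" if "r \<in> relator_ideal" for r
      using plus[OF that pq] by (intro exI[of _ "r + (p - q)"]) simp
    moreover have "\<exists>s. r + q = s + p \<and> s \<in> relator_ideal" if "r \<in> relator_ideal" for r
      using plus[OF that uminus[OF pq]] by (intro exI[of _ "r + - (p - q)"]) simp
    ultimately show "residue p = residue q" unfolding residue_eq by blast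
  qed
qed

lemma residue_mult_cong:
  "residue p = residue p' \<Longrightarrow> residue q = residue q' \<Longrightarrow> residue (p * q) = residue (p' * q')"
  by (simp flip: leavitt_mult)

lemma residue_add_cong:
  "residue p = residue p' \<Longrightarrow> residue q = residue q' \<Longrightarrow> residue (p + q) = residue (p' + q')"
  by (simp flip: leavitt_add)

lemma residue_eqI:
  fixes p q :: "'k::field free_algebra"
  assumes "p - q \<in> relators \<or> q - p \<in> relators"
  shows "residue p = residue q"
proof -
  have "r \<in> relator_ideal" if "r \<in> relators" for r :: "'k free_algebra"
    using ring.genideal_self[OF ring_free_ring, of relators] that
    by (auto simp: relator_ideal_def)
  then show ?thesis using assms residue_eq_iff by metis
qed

lemma residue_relators:
  "residue (gen gv * gen gv) = residue (gen gv)"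
  "residue (gen gw * gen gw) = residue (gen gw)"
  "residue (gen gv * gen gw) = residue 0"
  "residue (gen gw * gen gv) = residue 0"
  "residue (gen gv * gen gc) = residue (gen gc)"
  "residue (gen gc * gen gv) = residue (gen gc)"
  "residue (gen gv * gen gc_star) = residue (gen gc_star)"
  "residue (gen gc_star * gen gv) = residue (gen gc_star)"
  "residue (gen gv * gen gd) = residue (gen gd)"
  "residue (gen gd * gen gw) = residue (gen gd)"
  "residue (gen gw * gen gd_star) = residue (gen gd_star)"
  "residue (gen gd_star * gen gv) = residue (gen gd_star)"
  "residue (gen gc_star * gen gc) = residue (gen gv)"
  "residue (gen gd_star * gen gd) = residue (gen gw)"
  "residue (gen gc_star * gen gd) = residue 0"
  "residue (gen gd_star * gen gc) = residue 0"
  by (rule residue_eqI; simp add: relators_def Let_def)+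

lemma residue_assoc_left:
  "residue (p * q) = residue s \<Longrightarrow> residue (p * (q * r)) = residue (s * r)"
  by (metis residue_mult_cong mult.assoc)

lemma residue_assoc_right:
  "residue (q * r) = residue s \<Longrightarrow> residue (p * q * r) = residue (p * s)"
  by (metis residue_mult_cong mult.assoc)

text \<open>
  Two factors that are supported at different vertices have product zero, although no relator
  states this: the orthogonality of \<open>v\<close> and \<open>w\<close> has to be inserted between them.
\<close>

lemma residue_orthogonal:
  assumes p: "residue (p * e) = residue p" and q: "residue (e' * q) = residue q"
    and ee': "residue (e * e') = residue 0"
  shows "residue (p * q) = residue 0"
proof -
  have "residue (p * q) = residue ((p * e) * (e' * q))"
    by (rule residue_mult_cong) (simp_all add: p q)
  also have "\<dots> = residue (p * (e * e') * q)" by (simp add: mult.assoc)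
  also have "\<dots> = residue (p * 0 * q)" by (intro residue_mult_cong refl ee')
  finally show ?thesis by simp
qed

lemma residue_noncomposable:
  "residue (gen gw * gen gc) = residue 0"
  "residue (gen gw * gen gc_star) = residue 0"
  "residue (gen gw * gen gd) = residue 0"
  "residue (gen gc * gen gw) = residue 0"
  "residue (gen gc_star * gen gw) = residue 0"
  "residue (gen gd_star * gen gw) = residue 0"
  "residue (gen gd * gen gd) = residue 0"
  "residue (gen gd * gen gc) = residue 0"
  "residue (gen gc_star * gen gd_star) = residue 0"
  "residue (gen gd_star * gen gd_star) = residue 0"
proof -
  note vw = residue_orthogonal[OF _ _ residue_relators(3)]
    and wv = residue_orthogonal[OF _ _ residue_relators(4)]
  show "residue (gen gw * gen gc) = residue 0" by (rule wv) (simp_all add: residue_relators)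
  show "residue (gen gw * gen gc_star) = residue 0" by (rule wv) (simp_all add: residue_relators)
  show "residue (gen gw * gen gd) = residue 0" by (rule wv) (simp_all add: residue_relators)
  show "residue (gen gc * gen gw) = residue 0" by (rule vw) (simp_all add: residue_relators)
  show "residue (gen gc_star * gen gw) = residue 0" by (rule vw) (simp_all add: residue_relators)
  show "residue (gen gd_star * gen gw) = residue 0" by (rule vw) (simp_all add: residue_relators)
  show "residue (gen gd * gen gd) = residue 0" by (rule wv) (simp_all add: residue_relators)
  show "residue (gen gd * gen gc) = residue 0" by (rule wv) (simp_all add: residue_relators)
  show "residue (gen gc_star * gen gd_star) = residue 0" by (rule vw) (simp_all add: residue_relators)
  show "residue (gen gd_star * gen gd_star) = residue 0" by (rule vw) (simp_all add: residue_relators)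
qed

text \<open>
  The columns form the basis of \<open>R w\<close> that indexes the series; the rows are their images under the
  involution of \<open>R\<close> and form a basis of \<open>w R\<close>.
\<close>

fun col :: "index \<Rightarrow> 'k::field free_algebra" where
  "col W = gen gw"
| "col (CD i) = gen gc ^ i * gen gd"

fun row :: "index \<Rightarrow> 'k::field free_algebra" where
  "row W = gen gw"
| "row (CD i) = gen gd_star * gen gc_star ^ i"

text \<open>
  This table is \<^const>\<open>gen_act\<close> on the unit series, already valid in \<open>R w\<close>.
\<close>

lemma gen_times_col:
  "residue (gen gv * col W) = residue (0 :: 'k::field free_algebra)"
  "residue (gen gw * col W) = residue (col W :: 'k free_algebra)"
  "residue (gen gc * col W) = residue (0 :: 'k free_algebra)"
  "residue (gen gc_star * col W) = residue (0 :: 'k free_algebra)"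
  "residue (gen gd * col W) = residue (col (CD 0) :: 'k free_algebra)"
  "residue (gen gd_star * col W) = residue (0 :: 'k free_algebra)"
  "residue (gen gv * col (CD i)) = residue (col (CD i) :: 'k free_algebra)"
  "residue (gen gw * col (CD i)) = residue (0 :: 'k free_algebra)"
  "residue (gen gc * col (CD i)) = residue (col (CD (Suc i)) :: 'k free_algebra)"
  "residue (gen gc_star * col (CD 0)) = residue (0 :: 'k free_algebra)"
  "residue (gen gc_star * col (CD (Suc i))) = residue (col (CD i) :: 'k free_algebra)"
  "residue (gen gd * col (CD i)) = residue (0 :: 'k free_algebra)"
  "residue (gen gd_star * col (CD 0)) = residue (col W :: 'k free_algebra)"
  "residue (gen gd_star * col (CD (Suc i))) = residue (0 :: 'k free_algebra)"
proof -
  \<comment> \<open>For generators other than \<open>c\<close>, the product with \<open>c\<^sup>i d\<close>, \<open>i > 0\<close>, is settled by the product with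
    the leading \<open>c\<close>; where that product is \<open>v\<close>, the vertex is absorbed by the rest.\<close>
  have Suc: "col (CD (Suc i)) = (gen gc * col (CD i) :: 'k free_algebra)" for i
    by (simp add: mult.assoc)
  have v: "residue (gen gv * col (CD i)) = residue (col (CD i) :: 'k free_algebra)" for i
    by (cases i) (simp_all only: Suc residue_assoc_left[OF residue_relators(5)],
        simp add: residue_relators)
  show "residue (gen gv * col (CD i)) = residue (col (CD i) :: 'k free_algebra)" by (rule v)
  show "residue (gen gc * col (CD i)) = residue (col (CD (Suc i)) :: 'k free_algebra)"
    by (simp only: Suc)
  show "residue (gen gc_star * col (CD (Suc i))) = residue (col (CD i) :: 'k free_algebra)"
    using v[of i] by (simp only: Suc residue_assoc_left[OF residue_relators(13)])
  show "residue (gen gd_star * col (CD (Suc i))) = residue (0 :: 'k free_algebra)"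
    by (simp only: Suc residue_assoc_left[OF residue_relators(16)] mult_zero_left)
  show "residue (gen gw * col (CD i)) = residue (0 :: 'k free_algebra)"
    by (cases i) (simp_all only: Suc residue_assoc_left[OF residue_noncomposable(1)],
        simp_all add: residue_noncomposable)
  show "residue (gen gd * col (CD i)) = residue (0 :: 'k free_algebra)"
    by (cases i) (simp_all only: Suc residue_assoc_left[OF residue_noncomposable(8)],
        simp_all add: residue_noncomposable)
qed (simp_all add: residue_relators residue_noncomposable)

lemma gen_times_col_cases:
  obtains "residue (gen g * col b) = residue (0 :: 'k::field free_algebra)"
  | b' where "residue (gen g * col b) = residue (col b' :: 'k free_algebra)"
proof (cases b)
  case W
  then show thesis using that gen_times_col(1-6)[where 'k='k] by (cases g) metis+
next
  case (CD i)
  then show thesis using that gen_times_col(7-14)[where 'k='k] by (cases g; cases i) metis+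
qed

text \<open>
  This table is the transpose of \<^const>\<open>gen_act\<close>: a series \<open>y\<close>, read as a functional on rows,
  satisfies \<open>gen_act g y b = y (row b \<cdot> g)\<close> for each generator \<open>g\<close>.
\<close>

lemma row_times_gen:
  "residue (row W * gen gv) = residue (0 :: 'k::field free_algebra)"
  "residue (row W * gen gw) = residue (row W :: 'k free_algebra)"
  "residue (row W * gen gc) = residue (0 :: 'k free_algebra)"
  "residue (row W * gen gc_star) = residue (0 :: 'k free_algebra)"
  "residue (row W * gen gd) = residue (0 :: 'k free_algebra)"
  "residue (row W * gen gd_star) = residue (row (CD 0) :: 'k free_algebra)"
  "residue (row (CD i) * gen gv) = residue (row (CD i) :: 'k free_algebra)"
  "residue (row (CD i) * gen gw) = residue (0 :: 'k free_algebra)"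
  "residue (row (CD 0) * gen gc) = residue (0 :: 'k free_algebra)"
  "residue (row (CD (Suc i)) * gen gc) = residue (row (CD i) :: 'k free_algebra)"
  "residue (row (CD i) * gen gc_star) = residue (row (CD (Suc i)) :: 'k free_algebra)"
  "residue (row (CD 0) * gen gd) = residue (row W :: 'k free_algebra)"
  "residue (row (CD (Suc i)) * gen gd) = residue (0 :: 'k free_algebra)"
  "residue (row (CD i) * gen gd_star) = residue (0 :: 'k free_algebra)"
proof -
  have Suc: "row (CD (Suc i)) = (row (CD i) * gen gc_star :: 'k free_algebra)" for i
    by (simp only: row.simps power_Suc2 mult.assoc)
  have v: "residue (row (CD i) * gen gv) = residue (row (CD i) :: 'k free_algebra)" for i
    by (cases i) (simp_all only: Suc, simp_all add: residue_relators residue_assoc_right)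
  show "residue (row (CD i) * gen gv) = residue (row (CD i) :: 'k free_algebra)" by (rule v)
  show "residue (row (CD i) * gen gc_star) = residue (row (CD (Suc i)) :: 'k free_algebra)"
    by (simp only: Suc)
  show "residue (row (CD (Suc i)) * gen gc) = residue (row (CD i) :: 'k free_algebra)"
    using v[of i] by (simp only: Suc residue_assoc_right[OF residue_relators(13)])
  show "residue (row (CD (Suc i)) * gen gd) = residue (0 :: 'k free_algebra)"
    by (simp only: Suc residue_assoc_right[OF residue_relators(15)] mult_zero_right)
  show "residue (row (CD i) * gen gw) = residue (0 :: 'k free_algebra)"
    by (cases i) (simp_all only: Suc, simp_all add: residue_noncomposable residue_assoc_right)
  show "residue (row (CD i) * gen gd_star) = residue (0 :: 'k free_algebra)"
    by (cases i) (simp_all only: Suc, simp_all add: residue_noncomposable residue_assoc_right)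
qed (simp_all add: residue_relators residue_noncomposable)

definition scalar :: "'k::field \<Rightarrow> 'k free_algebra" where
  "scalar a = Poly_Mapping.single 0 a"

lemma scalar_hom:
  "scalar (a + b) = scalar a + scalar b" "scalar (a * b) = scalar a * scalar b"
  "scalar 1 = 1" "scalar 0 = 0"
  by (simp_all add: scalar_def single_add mult_single)

lemma scalar_commute: "scalar a * p = p * scalar a"
  by (induction p rule: free_algebra_induct)
    (simp_all add: scalar_def mult_single mult.commute distrib_left distrib_right)

lemma free_act_scalar: "free_act (scalar a) y = (\<lambda>b. a * y b)"
  by (simp add: scalar_def free_act_single word_act_0)

text \<open>
  For properties that are compatible with sums and products, such as commuting with the action of an
  element for all arguments at once, it suffices to look at scalars and generators.
\<close>

lemma free_algebra_gen_induct [case_names plus times scalar gen]: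
  assumes plus: "\<And>p q. P p \<Longrightarrow> P q \<Longrightarrow> P (p + q)" and times: "\<And>p q. P p \<Longrightarrow> P q \<Longrightarrow> P (p * q)"
    and scalar: "\<And>a. P (scalar a)" and gen: "\<And>g. P (gen g)"
  shows "P (p :: 'k::field free_algebra)"
proof (induction p rule: free_algebra_induct)
  case zero
  show ?case using scalar[of 0] by (simp add: scalar_hom)
next
  case (single u a)
  have "P (Poly_Mapping.single (Word us) a)" for us
  proof (induction us arbitrary: a)
    case Nil
    show ?case using scalar[of a] by (simp add: scalar_def zero_word_def)
  next
    case (Cons g us)
    have "Poly_Mapping.single (Word (g # us)) a = gen g * Poly_Mapping.single (Word us) a"
      by (simp add: gen_def mult_single plus_word_def)
    then show ?case using times[OF gen Cons] by simp
  qed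
  then show ?case by (cases u) simp
qed (rule plus)

section \<open>The left ideal generated by \<open>w\<close>\<close>

lemma free_act_residue_cong: "residue p = residue q \<Longrightarrow> free_act p y = free_act q y"
  by (metis smult_residue)

lemma free_act_0_right: "free_act p (\<lambda>b. 0) = (\<lambda>b. 0)"
  using free_act_scale[of p 0 "\<lambda>b. 0"] by simp

lemma free_act_col: "free_act (col b) (series_of W) = (series_of b :: 'k::field series)"
proof (cases b)
  case W
  have "free_act (gen gw) (series_of W) = (series_of W :: 'k series)"
    using ideal_embed_w unfolding ideal_embed_def smult_residue .
  then show ?thesis by (simp add: W del: free_act_gen)
next
  case (CD i)
  then show ?thesis
    using ideal_embed_c_d[of i] unfolding ideal_embed_def smult_residue by simp
qed

text \<open>
  Rows read off coefficients, which identifies \<open>Y\<close> with the dual of \<open>w R\<close>.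
\<close>

lemma free_act_row: "free_act (row b) y = (\<lambda>b'. y b * series_of W b')"
proof (cases b)
  case W
  then show ?thesis by (auto simp: series_of_def fun_eq_iff split: index.split)
next
  case (CD i)
  have "free_act (gen gc_star ^ i) y (CD j) = y (CD (i + j))" for j
    by (induction i arbitrary: j) (simp_all add: free_act_one free_act_times)
  then show ?thesis
    by (auto simp: CD free_act_times series_of_def fun_eq_iff split: index.split)
qed

lemma ex_free_act_eq_w:
  assumes "y \<noteq> (\<lambda>b. 0)"
  shows "\<exists>p. free_act p y = series_of W"
proof -
  obtain b where "y b \<noteq> 0" using assms by auto
  then have "free_act (scalar (inverse (y b)) * row b) y = series_of W"
    by (simp add: free_act_times free_act_scalar free_act_row flip: mult.assoc)
  then show ?thesis by blast
qed

text \<open>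
  A representative of the element of \<open>R w\<close> that the embedding takes to the finite series \<open>y\<close>. For a series with infinite support the sum takes the
  default value \<open>0\<close>, so statements about it have to secure finite support.
\<close>

definition combination :: "'k::field series \<Rightarrow> 'k free_algebra" where
  "combination y = (\<Sum>b\<in>{b. y b \<noteq> 0}. scalar (y b) * col b)"

lemma combination_superset:
  assumes "finite S" "{b. y b \<noteq> 0} \<subseteq> S"
  shows "combination y = (\<Sum>b\<in>S. scalar (y b) * col b)"
  unfolding combination_def
  by (rule sum.mono_neutral_left) (use assms in \<open>auto simp: scalar_hom\<close>)

lemma combination_add:
  assumes "finite {b. y b \<noteq> 0}" "finite {b. z b \<noteq> 0}"
  shows "combination (\<lambda>b. y b + z b) = combination y + combination z"
proof -
  let ?S = "{b. y b \<noteq> 0} \<union> {b. z b \<noteq> 0}"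
  have "finite ?S" using assms by simp
  moreover have "{b. y b + z b \<noteq> 0} \<subseteq> ?S" by auto
  ultimately show ?thesis
    by (simp add: combination_superset[of ?S] scalar_hom distrib_right sum.distrib)
qed

lemma combination_series_of: "combination (\<lambda>b'. a * series_of b b') = scalar a * col b"
proof -
  have "{b'. a * series_of b b' \<noteq> 0} \<subseteq> {b}" by (auto simp: series_of_def)
  then show ?thesis by (simp add: combination_superset[of "{b}"] series_of_def)
qed

lemma word_times_w:
  obtains "residue (Poly_Mapping.single u 1 * gen gw) = residue (0 :: 'k::field free_algebra)"
  | b where "residue (Poly_Mapping.single u 1 * gen gw) = residue (col b :: 'k free_algebra)"
proof -
  let ?w = "gen gw :: 'k free_algebra"
  have "residue (Poly_Mapping.single (Word us) 1 * ?w) = residue 0 \<or>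
      (\<exists>b. residue (Poly_Mapping.single (Word us) 1 * ?w) = residue (col b))" for us
  proof (induction us)
    case Nil
    have "Poly_Mapping.single (Word []) 1 * ?w = col W"
      by (simp flip: zero_word_def)
    then show ?case by metis
  next
    case (Cons g us)
    have "Poly_Mapping.single (Word (g # us)) 1 * ?w
        = gen g * (Poly_Mapping.single (Word us) 1 * ?w)"
      by (simp add: gen_def mult_single plus_word_def flip: mult.assoc)
    then show ?case
      using Cons gen_times_col_cases[of g] residue_mult_cong[of "gen g" "gen g"]
      by (metis mult_zero_right)
  qed
  then show thesis using that by (metis word.exhaust)
qed

lemma finite_support_ideal: "finite {b. free_act (p * gen gw) (series_of W) b \<noteq> 0}"
  using ideal_embed_image unfolding carrier_left_ideal_w image_image ideal_embed_def smult_residue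
  by blast

text \<open>
  Injectivity of the embedding rests on this: a product \<open>u w\<close> with a word \<open>u\<close> is congruent to a column or
  to \<open>0\<close>, and which of them it is can be seen from its action on \<open>w \<in> Y\<close>.
\<close>

lemma residue_eq_combination:
  "residue (p * gen gw) = residue (combination (free_act (p * gen gw) (series_of W)))"
proof (induction p rule: free_algebra_induct)
  case zero
  show ?case by (simp add: combination_def)
next
  case (plus p q)
  then show ?case
    unfolding distrib_right free_act_plus combination_add[OF finite_support_ideal finite_support_ideal]
    by (rule residue_add_cong)
next
  case (single u a)
  have eq: "Poly_Mapping.single u a * gen gw = scalar a * (Poly_Mapping.single u 1 * gen gw)"
    by (simp add: scalar_def mult_single flip: mult.assoc)
  show ?case
  proof (cases u rule: word_times_w[where 'k='a])
    case 1
    have "free_act (Poly_Mapping.single u a * gen gw) (series_of W) = (\<lambda>b. 0)"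
      by (simp only: eq free_act_times[of "scalar a"] free_act_residue_cong[OF 1] free_act_0
          free_act_0_right)
    then show ?thesis
      using residue_mult_cong[OF refl 1, of "scalar a"]
      by (simp add: combination_def flip: eq)
  next
    case (2 b)
    have "free_act (Poly_Mapping.single u a * gen gw) (series_of W) = (\<lambda>b'. a * series_of b b')"
      using free_act_residue_cong[OF 2, of "series_of W"]
      by (simp only: eq free_act_times[of "scalar a"] free_act_scalar free_act_col)
    then show ?thesis
      using residue_mult_cong[OF refl 2, of "scalar a"]
      by (simp only: eq combination_series_of)
  qed
qed

lemma ideal_embed_residue: "ideal_embed (residue p) = free_act p (series_of W)"
  by (simp add: ideal_embed_def smult_residue)

lemma ideal_embed_inj: "inj_on ideal_embed (carrier left_ideal_w)"
  by (rule inj_onI) (auto simp: carrier_left_ideal_w ideal_embed_residue simp del: free_act_gen,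
      (metis residue_eq_combination)+)

lemma leavitt_zero: "\<zero>\<^bsub>leavitt\<^esub> = residue 0"
  by (simp add: leavitt_def FactRing_def residue_eq)

lemma left_ideal_w_simps [simp]:
  "\<zero>\<^bsub>left_ideal_w\<^esub> = residue 0"
  "residue p \<oplus>\<^bsub>left_ideal_w\<^esub> residue q = residue (p + q)"
  "residue p \<odot>\<^bsub>left_ideal_w\<^esub> residue q = residue (p * q)"
  by (simp_all add: left_ideal_w_def leavitt_zero leavitt_add leavitt_mult)

lemma series_module_simps [simp]:
  "carrier series_module = UNIV"
  "\<zero>\<^bsub>series_module\<^esub> = (\<lambda>b. 0)"
  "y \<oplus>\<^bsub>series_module\<^esub> z = (\<lambda>b. y b + z b)"
  by (simp_all add: series_module_def)

lemma left_module_left_ideal_w: "left_module leavitt left_ideal_w"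
proof (intro left_module.intro ring_leavitt left_module_axioms.intro)
  have in_carrier: "residue (p * gen gw) \<in> carrier left_ideal_w" for p :: "'a free_algebra"
    by (auto simp: carrier_left_ideal_w)
  show "abelian_group (left_ideal_w :: ('a free_algebra set, _) module)"
  proof (rule abelian_groupI)
    fix x :: "'a free_algebra set" assume "x \<in> carrier left_ideal_w"
    then obtain p where "x = residue (p * gen gw)" by (auto simp: carrier_left_ideal_w)
    then show "\<exists>y\<in>carrier left_ideal_w. y \<oplus>\<^bsub>left_ideal_w\<^esub> x = \<zero>\<^bsub>left_ideal_w\<^esub>"
      using in_carrier[of "- p"] by (intro bexI) auto
  qed (use in_carrier[of 0] in \<open>auto simp: carrier_left_ideal_w ac_simps simp flip: distrib_right\<close>)
qed (auto simp: carrier_left_ideal_w carrier_leavitt leavitt_add leavitt_mult leavitt_one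
    algebra_simps simp flip: mult.assoc)

lemma ideal_embed_hom: "ideal_embed \<in> module_homs leavitt left_ideal_w series_module"
  by (rule module_homsI)
    (auto simp: carrier_left_ideal_w carrier_leavitt ideal_embed_residue free_act_plus
      free_act_times smult_residue simp del: free_act_gen)

lemma submodule_zero: "submodule N R M \<Longrightarrow> \<zero>\<^bsub>M\<^esub> \<in> N"
  using subgroup.one_closed[OF submodule.axioms(1)] by force

lemma submodule_subset: "submodule N R M \<Longrightarrow> N \<subseteq> carrier M"
  using subgroup.subset[OF submodule.axioms(1)] by force

text \<open>
  The element that takes a nonzero \<open>x\<close> to \<open>w\<close> is found in \<open>Y\<close>, where coefficients are available, and
  the equation is pulled back along the injective \<^const>\<open>ideal_embed\<close>.
\<close>

lemma simple_left_ideal_w: "simple_module leavitt left_ideal_w"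
  unfolding simple_module_def
proof (intro conjI allI impI)
  let ?M = "left_ideal_w :: ('a free_algebra set, _) module"
  have w: "residue (gen gw) \<in> carrier ?M"
    using residue_relators(2) unfolding carrier_left_ideal_w by blast
  have embed0: "ideal_embed (residue 0) = (\<lambda>b. 0 :: 'a)"
    by (simp add: ideal_embed_residue)
  have "series_of W \<noteq> (\<lambda>b. 0 :: 'a)" by (auto simp: series_of_def fun_eq_iff)
  then have "residue (gen gw) \<noteq> (residue 0 :: 'a free_algebra set)"
    using ideal_embed_w embed0 by metis
  then show "carrier ?M \<noteq> {\<zero>\<^bsub>?M\<^esub>}" using w by auto
  fix N assume N: "submodule N leavitt ?M"
  show "N = {\<zero>\<^bsub>?M\<^esub>} \<or> N = carrier ?M"
  proof (cases "N \<subseteq> {\<zero>\<^bsub>?M\<^esub>}")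
    case True
    then show ?thesis using submodule_zero[OF N] by blast
  next
    case False
    then obtain x where x: "x \<in> N" "x \<noteq> residue 0" by auto
    then have xM: "x \<in> carrier ?M" using submodule_subset[OF N] by blast
    have "residue 0 \<in> carrier ?M"
      using submodule_subset[OF N] submodule_zero[OF N] by auto
    then have "ideal_embed x \<noteq> (\<lambda>b. 0)"
      using inj_onD[OF ideal_embed_inj _ xM] x embed0 by metis
    then obtain p where p: "free_act p (ideal_embed x) = series_of W"
      using ex_free_act_eq_w by blast
    have r: "residue p \<in> carrier leavitt" by (simp add: carrier_leavitt)
    have "ideal_embed (residue p \<odot>\<^bsub>?M\<^esub> x) = ideal_embed (residue (gen gw))"
      using module_homsD(3)[OF ideal_embed_hom r xM] p by (simp add: smult_residue ideal_embed_w)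
    then have "residue p \<odot>\<^bsub>?M\<^esub> x = residue (gen gw)"
      using inj_onD[OF ideal_embed_inj _ _ w]
        left_module.smult_closed[OF left_module_left_ideal_w r xM] by blast
    then have wN: "residue (gen gw) \<in> N"
      using submodule.smult_closed[OF N r x(1)] by simp
    have "residue (q * gen gw) \<in> N" for q
      using submodule.smult_closed[OF N _ wN, of "residue q"] by (simp add: carrier_leavitt)
    then show ?thesis
      using submodule_subset[OF N] by (auto simp: carrier_left_ideal_w)
  qed
qed (rule left_module_left_ideal_w)

lemma essential_left_ideal_w:
  "essential_submodule leavitt (ideal_embed ` carrier left_ideal_w) series_module"
  unfolding essential_submodule_def
proof (intro conjI allI impI)
  let ?Y = "series_module :: ('a free_algebra set, _) module"
  let ?H = "ideal_embed ` carrier left_ideal_w :: 'a series set"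
  interpret Y: left_module leavitt ?Y by (rule left_module_series)
  show "submodule ?H leavitt ?Y"
  proof (intro submodule.intro submodule_axioms.intro)
    have "group_hom (add_monoid left_ideal_w) (add_monoid ?Y) ideal_embed"
      using ideal_embed_hom left_module.axioms(2)[OF left_module_left_ideal_w]
      by (intro group_hom.intro group_hom_axioms.intro abelian_group.a_group)
        (auto simp: module_homs_def Y.abelian_group_axioms)
    then show "subgroup ?H (add_monoid ?Y)"
      using group_hom.img_is_subgroup by fastforce
    fix r :: "'a free_algebra set" and y assume r: "r \<in> carrier leavitt" and "y \<in> ?H"
    then obtain x where x: "x \<in> carrier left_ideal_w" "y = ideal_embed x" by blast
    show "r \<odot>\<^bsub>?Y\<^esub> y \<in> ?H"
      using module_homsD(3)[OF ideal_embed_hom r x(1)] x(2)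
        left_module.smult_closed[OF left_module_left_ideal_w r x(1)] by (metis imageI)
  qed
  fix N assume N: "submodule N leavitt ?Y \<and> N \<noteq> {\<zero>\<^bsub>?Y\<^esub>}"
  then obtain y where y: "y \<in> N" "y \<noteq> (\<lambda>b. 0)"
    using submodule_zero[of N leavitt ?Y] by auto
  then obtain p where "free_act p y = series_of W" using ex_free_act_eq_w by blast
  then have "series_of W \<in> N"
    using submodule.smult_closed[of N leavitt ?Y "residue p" y] N y
    by (simp add: carrier_leavitt smult_residue)
  moreover have "series_of W \<in> ?H"
    by (simp add: ideal_embed_image series_of_def)
  moreover have "series_of W \<noteq> (\<lambda>b. 0 :: 'a)" by (auto simp: series_of_def fun_eq_iff)
  ultimately show "N \<inter> ?H \<noteq> {\<zero>\<^bsub>?Y\<^esub>}" by auto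
qed

section \<open>Injectivity\<close>

definition restrict_to_field ::
    "('k::field free_algebra set, 'm) module \<Rightarrow> ('k, 'm) module" where
  "restrict_to_field M =
    \<lparr>carrier = carrier M, monoid.mult = undefined, one = undefined,
     zero = \<zero>\<^bsub>M\<^esub>, add = (\<oplus>\<^bsub>M\<^esub>), module.smult = (\<lambda>a x. residue (scalar a) \<odot>\<^bsub>M\<^esub> x)\<rparr>"

definition field_module :: "('k::field, 'k) module" where
  "field_module =
    \<lparr>carrier = UNIV, monoid.mult = undefined, one = undefined,
     zero = 0, add = (+), module.smult = (*)\<rparr>"

lemma restrict_to_field_simps [simp]:
  "carrier (restrict_to_field M) = carrier M"
  "\<zero>\<^bsub>restrict_to_field M\<^esub> = \<zero>\<^bsub>M\<^esub>"
  "x \<oplus>\<^bsub>restrict_to_field M\<^esub> y = x \<oplus>\<^bsub>M\<^esub> y"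
  "a \<odot>\<^bsub>restrict_to_field M\<^esub> x = residue (scalar a) \<odot>\<^bsub>M\<^esub> x"
  by (simp_all add: restrict_to_field_def)

lemma field_module_simps [simp]:
  "carrier field_module = UNIV"
  "x \<oplus>\<^bsub>field_module\<^esub> y = x + y"
  "a \<odot>\<^bsub>field_module\<^esub> x = a * x"
  by (simp_all add: field_module_def)

lemma residue_in_leavitt [simp]: "residue p \<in> carrier leavitt"
  by (simp add: carrier_leavitt)

lemma left_module_restrict_to_field:
  fixes M :: "('k::field free_algebra set, 'm) module"
  assumes "left_module leavitt M"
  shows "left_module (ring_of_type_algebra :: 'k ring) (restrict_to_field M)"
proof -
  interpret M: left_module "leavitt :: 'k free_algebra set ring" M by (rule assms)
  have "abelian_group (restrict_to_field M)"
    by (rule abelian_groupI) (auto simp: M.a_ac intro: M.l_neg)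
  moreover have "ring (ring_of_type_algebra :: 'k ring)"
    by (intro cring.axioms(1) fieldE(1) field_from_type_algebra)
  ultimately show ?thesis
    by (intro left_module.intro left_module_axioms.intro)
      (simp_all add: ring_of_type_algebra_def scalar_hom M.smult_closed M.smult_r_distr
        M.smult_one flip: leavitt_add leavitt_mult leavitt_one M.smult_l_distr M.smult_assoc1)
qed

lemma left_module_field_module:
  "left_module (ring_of_type_algebra :: 'k::field ring) (field_module :: ('k, 'k) module)"
proof -
  have "abelian_group (field_module :: ('k, 'k) module)"
    by (rule abelian_groupI) (auto simp: field_module_def ac_simps intro: exI[of _ "- x" for x])
  moreover have "ring (ring_of_type_algebra :: 'k ring)"
    by (intro cring.axioms(1) fieldE(1) field_from_type_algebra)
  ultimately show ?thesis
    by (intro left_module.intro left_module_axioms.intro)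
      (simp_all add: ring_of_type_algebra_def algebra_simps)
qed

lemma injective_moduleD:
  fixes A :: "('r, 'a) module" and B :: "('r, 'b) module"
  assumes "injective_module TYPE('a) TYPE('b) R E" "left_module R A" "left_module R B"
    and "f \<in> module_homs R A B" "inj_on f (carrier A)" "g \<in> module_homs R A E"
  shows "\<exists>h\<in>module_homs R B E. \<forall>x\<in>carrier A. h (f x) = g x"
  using assms unfolding injective_module_def by blast

lemma module_homs_restrict:
  assumes "f \<in> module_homs leavitt M N"
  shows "f \<in> module_homs ring_of_type_algebra (restrict_to_field M) (restrict_to_field N)"
  by (rule module_homsI) (simp_all add: module_homsD[OF assms])

text \<open>
  The map \<open>Hom\<^sub>K (B, K) \<rightarrow> Hom\<^sub>R (B, Hom\<^sub>K (w R, K))\<close> that is dual to the multiplication of elements of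
  \<open>B\<close> by elements of \<open>w R\<close>, written in the coordinates given by the rows.
\<close>

lemma coinduced_hom:
  fixes B :: "('k::field free_algebra set, 'b) module"
  assumes B: "left_module leavitt B"
    and \<mu>: "\<mu> \<in> module_homs ring_of_type_algebra (restrict_to_field B) field_module"
  shows "(\<lambda>x b. \<mu> (residue (row b) \<odot>\<^bsub>B\<^esub> x)) \<in> module_homs leavitt B series_module"
proof -
  interpret B: left_module "leavitt :: 'k free_algebra set ring" B by (rule B)
  have \<mu>_add: "\<mu> (x \<oplus>\<^bsub>B\<^esub> y) = \<mu> x + \<mu> y" if "x \<in> carrier B" "y \<in> carrier B" for x y
    using module_homsD(2)[OF \<mu>] that by simp
  have \<mu>_scale: "\<mu> (residue (scalar a) \<odot>\<^bsub>B\<^esub> x) = a * \<mu> x" if "x \<in> carrier B" for a x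
    using module_homsD(3)[OF \<mu>] that by (simp add: ring_of_type_algebra_def)
  have act_add: "residue (p + q) \<odot>\<^bsub>B\<^esub> x = residue p \<odot>\<^bsub>B\<^esub> x \<oplus>\<^bsub>B\<^esub> residue q \<odot>\<^bsub>B\<^esub> x"
    if "x \<in> carrier B" for p q x
    using that by (simp add: B.smult_l_distr flip: leavitt_add)
  have act_mult: "residue p \<odot>\<^bsub>B\<^esub> (residue q \<odot>\<^bsub>B\<^esub> x) = residue (p * q) \<odot>\<^bsub>B\<^esub> x"
    if "x \<in> carrier B" for p q x
    using that by (simp add: B.smult_assoc1 flip: leavitt_mult)
  have \<mu>_0: "\<mu> (residue 0 \<odot>\<^bsub>B\<^esub> x) = 0" if "x \<in> carrier B" for x
    using \<mu>_scale[OF that, of 0] by (simp add: scalar_hom)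
  define h where "h x b = \<mu> (residue (row b) \<odot>\<^bsub>B\<^esub> x)" for x b
  have h_add: "h (x \<oplus>\<^bsub>B\<^esub> y) = (\<lambda>b. h x b + h y b)" if "x \<in> carrier B" "y \<in> carrier B" for x y
    using that by (simp add: h_def fun_eq_iff B.smult_r_distr \<mu>_add B.smult_closed)
  have h_act: "h (residue p \<odot>\<^bsub>B\<^esub> x) = free_act p (h x)" if "x \<in> carrier B" for p x
    using that
  proof (induction p arbitrary: x rule: free_algebra_gen_induct)
    case (plus p q)
    then show ?case by (simp add: act_add h_add B.smult_closed free_act_plus)
  next
    case (times p q)
    then show ?case by (simp add: free_act_times B.smult_closed flip: act_mult)
  next
    case (scalar a)
    have "h (residue (scalar a) \<odot>\<^bsub>B\<^esub> x) b = a * h x b" for b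
    proof -
      have "h (residue (scalar a) \<odot>\<^bsub>B\<^esub> x) b = \<mu> (residue (scalar a * row b) \<odot>\<^bsub>B\<^esub> x)"
        using scalar by (simp add: h_def act_mult scalar_commute)
      also have "\<dots> = \<mu> (residue (scalar a) \<odot>\<^bsub>B\<^esub> (residue (row b) \<odot>\<^bsub>B\<^esub> x))"
        using scalar by (simp only: act_mult)
      also have "\<dots> = a * h x b"
        using scalar by (simp add: h_def \<mu>_scale B.smult_closed)
      finally show ?thesis .
    qed
    then show ?case by (simp add: fun_eq_iff free_act_scalar)
  next
    case (gen g)
    have "\<mu> (residue (row b * gen g) \<odot>\<^bsub>B\<^esub> x) = gen_act g (h x) b" for b
    proof (cases b)
      case W
      then show ?thesis
        using gen by (cases g) (simp_all only: row_times_gen gen_act.simps h_def \<mu>_0 index.case)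
    next
      case (CD i)
      then show ?thesis
        using gen by (cases g; cases i)
          (simp_all only: row_times_gen gen_act.simps h_def \<mu>_0 index.case nat.case)
    qed
    then show ?case using gen by (simp add: h_def[of "residue _ \<odot>\<^bsub>B\<^esub> x"] fun_eq_iff act_mult)
  qed
  have "h \<in> module_homs leavitt B series_module"
    by (rule module_homsI) (auto simp: h_add h_act carrier_leavitt smult_residue)
  then show ?thesis unfolding h_def[abs_def] .
qed

text \<open>
  The functional \<open>x \<mapsto> g x W\<close> on \<open>A\<close> is extended along \<open>f\<close> to \<open>B\<close>. The homomorphism that the extension
  induces agrees with \<open>g\<close> on \<open>A\<close> because the remaining coefficients of \<open>g x\<close> are the \<open>w\<close>-coefficients
  of \<open>row b \<cdot> g x = g (row b \<cdot> x)\<close>.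
\<close>

lemma injective_series_module:
  "injective_module TYPE('a) TYPE('b) (leavitt :: 'k::field free_algebra set ring) series_module"
  unfolding injective_module_def
proof (intro conjI allI impI)
  let ?R = "leavitt :: 'k free_algebra set ring" and ?K = "ring_of_type_algebra :: 'k ring"
  fix A :: "('k free_algebra set, 'a) module" and B :: "('k free_algebra set, 'b) module" and f g
  assume "left_module ?R A \<and> left_module ?R B \<and>
    f \<in> module_homs ?R A B \<and> inj_on f (carrier A) \<and> g \<in> module_homs ?R A series_module"
  then have A: "left_module ?R A" and B: "left_module ?R B" and f: "f \<in> module_homs ?R A B"
    and inj: "inj_on f (carrier A)" and g: "g \<in> module_homs ?R A series_module" by auto
  have gW: "(\<lambda>x. g x W) \<in> module_homs ?K (restrict_to_field A) field_module"
    by (rule module_homsI)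
      (simp_all add: module_homsD[OF g] smult_residue free_act_scalar)
  have "injective_module TYPE('a) TYPE('b) ?K field_module"
    by (rule vector_space_injective[OF field_from_type_algebra left_module_field_module])
  from injective_moduleD[OF this left_module_restrict_to_field[OF A]
      left_module_restrict_to_field[OF B] module_homs_restrict[OF f] _ gW] inj
  obtain \<mu> where \<mu>: "\<mu> \<in> module_homs ?K (restrict_to_field B) field_module"
    and \<mu>f: "\<forall>x\<in>carrier A. \<mu> (f x) = g x W"
    by auto
  let ?h = "\<lambda>x b. \<mu> (residue (row b) \<odot>\<^bsub>B\<^esub> x)"
  have "?h (f x) = g x" if x: "x \<in> carrier A" for x
  proof
    fix b
    have "?h (f x) b = \<mu> (f (residue (row b) \<odot>\<^bsub>A\<^esub> x))"
      using module_homsD(3)[OF f _ x] by simp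
    also have "\<dots> = g (residue (row b) \<odot>\<^bsub>A\<^esub> x) W"
      using \<mu>f left_module.smult_closed[OF A _ x] by simp
    also have "\<dots> = free_act (row b) (g x) W"
      using module_homsD(3)[OF g _ x] by (simp add: smult_residue)
    also have "\<dots> = g x b" by (simp add: free_act_row series_of_def)
    finally show "?h (f x) b = g x b" .
  qed
  then show "\<exists>h\<in>module_homs ?R B series_module. \<forall>x\<in>carrier A. h (f x) = g x"
    by (intro bexI[OF _ coinduced_hom[OF B \<mu>]] ballI)
qed (rule left_module_series)

theorem corollary29:
  shows "simple_module (leavitt :: 'k::field free_algebra set ring) left_ideal_w \<and>
    injective_envelope TYPE('a) TYPE('b)
      (leavitt :: 'k free_algebra set ring) left_ideal_w series_module ideal_embed"
  unfolding injective_envelope_def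
proof (intro conjI)
  show "simple_module (leavitt :: 'k free_algebra set ring) left_ideal_w"
    by (rule simple_left_ideal_w)
  show "left_module (leavitt :: 'k free_algebra set ring) left_ideal_w"
    by (rule left_module_left_ideal_w)
  show "injective_module TYPE('a) TYPE('b) (leavitt :: 'k free_algebra set ring) series_module"
    by (rule injective_series_module)
  show "ideal_embed \<in> module_homs (leavitt :: 'k free_algebra set ring) left_ideal_w series_module"
    by (rule ideal_embed_hom)
  show "inj_on ideal_embed (carrier (left_ideal_w :: ('k free_algebra set, _) module))"
    by (rule ideal_embed_inj)
  show "essential_submodule (leavitt :: 'k free_algebra set ring)
      (ideal_embed ` carrier left_ideal_w) series_module"
    by (rule essential_left_ideal_w)
qed

end
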